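(* Let $V=\{1,\dots,n\}$, $m\ge1$, $0\le\lambda\le1$, $\bar\lambda=1-\lambda$, and let $f_1,\dots,f_m:2^V\to\mathbb{R}$ be normalized, monotone non-decreasing, submodular functions with Lovász extensions $\tilde f_1,\dots,\tilde f_m$. Let $(x_1^*,\dots,x_m^* )$ be an optimal solution of the convex program $$\min_{x_1,\dots,x_m\in[0,1]^n}\ \max_i \bar\lambda\tilde f_i(x_i)+\frac{\lambda}{m}\sum_{j=1}^m\tilde f_j(x_j)\quad\text{s.t.}\quad\sum_{i=1}^m x_i(j)\ge1\ \text{ for } j=1,\dots,n,$$ and let $\hat\pi$ be obtained by assigning each $j\in V$ to one block $\hat i\in\arg\max_i x_i^*(j)$ (ties broken arbitrarily). Then $$\max_i\bar\lambda f_i(A_i^{\hat\pi})+\frac{\lambda}{m}\sum_{j=1}^m f_j(A_j^{\hat\pi})\ \le\ m\min_{\pi\in\Pi}\Big[\max_i\bar\lambda f_i(A_i^{\pi})+\frac{\lambda}{m}\sum_{j=1}^m f_j(A_j^{\pi})\Big].$$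
   Context: $f$ is normalized if $f(\emptyset)=0$, monotone non-decreasing if $f(S)\le f(T)$ for $S\subseteq T$, submodular if $f(S)+f(T)\ge f(S\cup T)+f(S\cap T)$. $\Pi$ is the set of ordered partitions of $V$ into $m$ pairwise disjoint (possibly empty) blocks covering $V$. The Lovász extension of $f$: for $x\in[0,1]^n$, let $\sigma_x$ order the coordinates of $x$ non-increasingly, $S_j=\{\sigma_x(1),\dots,\sigma_x(j)\}$, $S_0=\emptyset$; then $\tilde f(x)=\sum_{j=1}^n x(\sigma_x(j))\,(f(S_j)-f(S_{j-1}))$. *)

theory Defs
  imports "HOL-Analysis.Analysis"
begin

definition submodular_on :: "'a set \<Rightarrow> ('a set \<Rightarrow> real) \<Rightarrow> bool" where
  "submodular_on V f \<longleftrightarrow>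
     (\<forall>S\<in>Pow V. \<forall>T\<in>Pow V. f S + f T \<ge> f (S \<union> T) + f (S \<inter> T))"

definition sorts_nonincreasing :: "nat \<Rightarrow> (nat \<Rightarrow> real) \<Rightarrow> (nat \<Rightarrow> nat) \<Rightarrow> bool" where
  "sorts_nonincreasing n x \<sigma> \<longleftrightarrow>
     bij_betw \<sigma> {1..n} {1..n} \<and> antimono_on {1..n} (\<lambda>j. x (\<sigma> j))"

(* Vectors in R^n are functions on nat, of which only the values on {1..n} matter.
   If x has ties there are several admissible orderings; an arbitrary one is chosen
   (the value of the sum does not depend on the choice). *)
definition lovasz_extension :: "nat \<Rightarrow> (nat set \<Rightarrow> real) \<Rightarrow> (nat \<Rightarrow> real) \<Rightarrow> real" where
  "lovasz_extension n f x =
     (let \<sigma> = (SOME \<sigma>. sorts_nonincreasing n x \<sigma>)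
      in \<Sum>j=1..n. x (\<sigma> j) * (f (\<sigma> ` {1..j}) - f (\<sigma> ` {1..j-1})))"

(* \<pi> i is the i-th block; blocks may be empty. *)
definition ordered_partitions :: "nat \<Rightarrow> nat \<Rightarrow> (nat \<Rightarrow> nat set) set" where
  "ordered_partitions n m =
     {\<pi> \<in> {1..m} \<rightarrow>\<^sub>E Pow {1..n}.
        disjoint_family_on \<pi> {1..m} \<and> (\<Union>i\<in>{1..m}. \<pi> i) = {1..n}}"

(* v i is the i-th cost: f i (\<pi> i) for a partition \<pi>, or the Lovasz extension of f i
   at x i for the relaxation. *)
definition mixed_objective :: "nat \<Rightarrow> real \<Rightarrow> (nat \<Rightarrow> real) \<Rightarrow> real" where
  "mixed_objective m lam v =
     (MAX i\<in>{1..m}. (1 - lam) * v i) + lam / real m * (\<Sum>j=1..m. v j)"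

definition feasible :: "nat \<Rightarrow> nat \<Rightarrow> (nat \<Rightarrow> nat \<Rightarrow> real) \<Rightarrow> bool" where
  "feasible n m x \<longleftrightarrow>
     (\<forall>i\<in>{1..m}. \<forall>j\<in>{1..n}. x i j \<in> {0..1}) \<and>
     (\<forall>j\<in>{1..n}. (\<Sum>i=1..m. x i j) \<ge> 1)"

definition optimal_solution ::
  "nat \<Rightarrow> nat \<Rightarrow> real \<Rightarrow> (nat \<Rightarrow> nat set \<Rightarrow> real) \<Rightarrow> (nat \<Rightarrow> nat \<Rightarrow> real) \<Rightarrow> bool" where
  "optimal_solution n m lam f x \<longleftrightarrow>
     is_arg_min (\<lambda>y. mixed_objective m lam (\<lambda>i. lovasz_extension n (f i) (y i)))
       (feasible n m) x"

definition assignment_blocks :: "nat \<Rightarrow> nat \<Rightarrow> (nat \<Rightarrow> nat) \<Rightarrow> nat \<Rightarrow> nat set" where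
  "assignment_blocks n m h = (\<lambda>i\<in>{1..m}. {j\<in>{1..n}. h j = i})"

lemma sorts_nonincreasing_exists: "\<exists>\<sigma>. sorts_nonincreasing n x \<sigma>"
proof -
  define xs where "xs = sort_key (\<lambda>j. - x j) [1..<Suc n]"
  have len: "length xs = n" and set: "set xs = {1..n}" and dist: "distinct xs"
    by (auto simp: xs_def)
  have srt: "sorted (map (\<lambda>j. - x j) xs)"
    by (simp add: xs_def)
  define \<sigma> where "\<sigma> j = xs ! (j - 1)" for j
  have "bij_betw (\<lambda>j. j - 1) {1..n} {..<n}"
    by (rule bij_betw_byWitness[where f' = Suc]) auto
  moreover have "bij_betw ((!) xs) {..<n} {1..n}"
    using bij_betw_nth[OF dist] len set by simp
  ultimately have "bij_betw \<sigma> {1..n} {1..n}"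
    unfolding \<sigma>_def using bij_betw_trans[of "\<lambda>j. j - 1" _ _ "(!) xs"] by (simp add: comp_def)
  moreover have "antimono_on {1..n} (\<lambda>j. x (\<sigma> j))"
  proof (rule monotone_onI)
    fix j k assume jk: "j \<in> {1..n}" "k \<in> {1..n}" "j \<le> k"
    then have "map (\<lambda>j. - x j) xs ! (j - 1) \<le> map (\<lambda>j. - x j) xs ! (k - 1)"
      using len by (intro sorted_nth_mono[OF srt]) auto
    then show "x (\<sigma> j) \<ge> x (\<sigma> k)"
      using jk len by (simp add: \<sigma>_def)
  qed
  ultimately show ?thesis
    unfolding sorts_nonincreasing_def by blast
qed

lemma finite_ordered_partitions: "finite (ordered_partitions n m)"
  unfolding ordered_partitions_def
  by (rule finite_subset[of _ "{1..m} \<rightarrow>\<^sub>E Pow {1..n}"]) (auto intro!: finite_PiE)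

lemma assignment_blocks_in_ordered_partitions:
  assumes "\<And>j. j \<in> {1..n} \<Longrightarrow> h j \<in> {1..m}"
  shows "assignment_blocks n m h \<in> ordered_partitions n m"
  using assms
  by (auto simp: ordered_partitions_def assignment_blocks_def disjoint_family_on_def)

lemma ordered_partitions_nonempty:
  assumes "m \<ge> 1"
  shows "ordered_partitions n m \<noteq> {}"
  using assignment_blocks_in_ordered_partitions[of n "\<lambda>_. 1" m] assms by auto

end

theory Submission
  imports Defs
begin

text \<open>
  If \<open>x \<ge> c \<ge> 0\<close> on \<open>A\<close>, then \<open>A\<close> lies in the upper level set \<open>{x \<ge> c}\<close>, which is one of the
  prefixes \<open>S\<^sub>k\<close> of the ordering. Truncating the sum defining the Lovasz extension at \<open>k\<close> and
  telescoping gives \<open>c f(A) \<le> c f(S\<^sub>k) \<le> f\<^sup>~(x)\<close> by monotonicity. The largest of \<open>m\<close> numbers with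
  sum at least 1 is at least \<open>1/m\<close>, so the blocks of the rounding satisfy
  \<open>f\<^sub>i(A\<^sub>i) \<le> m f\<^sup>~\<^sub>i(x\<^sub>i)\<close>. The objective is monotone and positively homogeneous, and the
  indicator vectors of any partition are feasible with the same objective value, so optimality
  of \<open>x\<close> bounds the rounded value by \<open>m\<close> times that of any partition.
\<close>

text \<open>An antitone \<open>g\<close> takes at every index below the last one of the level set a
  value at least as large, so the set has no gaps.\<close>

lemma antimono_on_superlevel_prefix:
  fixes g :: "nat \<Rightarrow> real"
  assumes "antimono_on {1..n} g"
  obtains k where "k \<le> n" "{j\<in>{1..n}. g j \<ge> c} = {1..k}"
proof
  define K where "K = {j\<in>{1..n}. g j \<ge> c}"
  \<comment> \<open>Inserting 0 keeps \<open>Max\<close> defined when \<open>K\<close> is empty;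
    then \<open>k = 0\<close> and the prefix \<open>{1..0}\<close> is empty too.\<close>
  define k where "k = Max (insert 0 K)"
  have fin: "finite (insert 0 K)" by (simp add: K_def)
  have k: "k = 0 \<or> k \<in> K"
    using Max_in[OF fin] by (auto simp: k_def)
  then show "k \<le> n" by (auto simp: K_def)
  have "K \<subseteq> {1..k}"
    using Max_ge[OF fin] by (auto simp: k_def K_def)
  moreover have "{1..k} \<subseteq> K"
  proof
    fix j assume j: "j \<in> {1..k}"
    with k have "k \<in> K" by auto
    with j have "g k \<le> g j"
      using monotone_onD[OF assms, of j k] by (auto simp: K_def)
    with j \<open>k \<in> K\<close> show "j \<in> K" by (auto simp: K_def)
  qed
  ultimately show "{j\<in>{1..n}. g j \<ge> c} = {1..k}"
    by (simp add: K_def)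
qed

text \<open>Hides the choice operator: later arguments use only that the chosen ordering is a
  sorting bijection.\<close>

lemma lovasz_extension_ordering:
  obtains \<sigma> where "bij_betw \<sigma> {1..n} {1..n}" "antimono_on {1..n} (\<lambda>j. x (\<sigma> j))"
    "lovasz_extension n f x = (\<Sum>j=1..n. x (\<sigma> j) * (f (\<sigma> ` {1..j}) - f (\<sigma> ` {1..j-1})))"
proof
  let ?\<sigma> = "SOME \<sigma>. sorts_nonincreasing n x \<sigma>"
  have "sorts_nonincreasing n x ?\<sigma>"
    by (rule someI_ex[OF sorts_nonincreasing_exists])
  then show "bij_betw ?\<sigma> {1..n} {1..n}" "antimono_on {1..n} (\<lambda>j. x (?\<sigma> j))"
    by (simp_all add: sorts_nonincreasing_def)
qed (simp only: lovasz_extension_def Let_def)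

lemma sum_prefix_increments:
  fixes f :: "'a set \<Rightarrow> real" and \<sigma> :: "nat \<Rightarrow> 'a"
  shows "(\<Sum>j=1..k. f (\<sigma> ` {1..j}) - f (\<sigma> ` {1..j-1})) = f (\<sigma> ` {1..k}) - f {}"
  \<comment> \<open>The leftover end term is the value on the image of \<open>{1..0}\<close>, that
    is \<open>f {}\<close>.\<close>
  using sum_telescope''[of 0 k "\<lambda>j. f (\<sigma> ` {1..j})"] by simp

lemma lovasz_extension_ge_level:
  assumes f0: "f {} = 0" and mono: "mono_on (Pow {1..n}) f"
    and x: "\<And>j. j \<in> {1..n} \<Longrightarrow> x j \<ge> 0"
    and A: "A \<subseteq> {1..n}" "\<And>j. j \<in> A \<Longrightarrow> x j \<ge> c" and c: "c \<ge> 0"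
  shows "c * f A \<le> lovasz_extension n f x"
proof -
  obtain \<sigma> where bij: "bij_betw \<sigma> {1..n} {1..n}" and anti: "antimono_on {1..n} (\<lambda>j. x (\<sigma> j))"
    and L: "lovasz_extension n f x =
      (\<Sum>j=1..n. x (\<sigma> j) * (f (\<sigma> ` {1..j}) - f (\<sigma> ` {1..j-1})))"
    by (rule lovasz_extension_ordering)
  obtain k where k: "k \<le> n" "{j\<in>{1..n}. x (\<sigma> j) \<ge> c} = {1..k}"
    by (rule antimono_on_superlevel_prefix[OF anti])
  have img: "\<sigma> ` {1..n} = {1..n}" using bij by (simp add: bij_betw_def)
  have prefix: "\<sigma> ` {1..j} \<subseteq> {1..n}" if "j \<le> n" for j
    using img image_mono[of "{1..j}" "{1..n}" \<sigma>] that by auto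
  have incr: "f (\<sigma> ` {1..j}) - f (\<sigma> ` {1..j-1}) \<ge> 0" if "j \<in> {1..n}" for j
    using mono_onD[OF mono, of "\<sigma> ` {1..j-1}" "\<sigma> ` {1..j}"] prefix[of j] prefix[of "j-1"] that
    by (force simp: image_mono)
  have "A \<subseteq> \<sigma> ` {1..k}"
  proof
    fix a assume a: "a \<in> A"
    then obtain j where "j \<in> {1..n}" "a = \<sigma> j" using A(1) img by blast
    with A(2)[OF a] k(2) show "a \<in> \<sigma> ` {1..k}" by blast
  qed
  then have "f A \<le> f (\<sigma> ` {1..k})"
    using mono_onD[OF mono, of A] A(1) prefix[OF k(1)] by blast
  then have "c * f A \<le> c * f (\<sigma> ` {1..k})" using c by (rule mult_left_mono)
  also have "\<dots> = (\<Sum>j=1..k. c * (f (\<sigma> ` {1..j}) - f (\<sigma> ` {1..j-1})))"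
    using sum_prefix_increments[of f \<sigma> k] f0 by (simp add: sum_distrib_left[symmetric])
  \<comment> \<open>Positions up to \<open>k\<close> lie in the level set, so \<open>c\<close> can
    be raised to \<open>x (\<sigma> j)\<close> in front of a nonnegative increment.\<close>
  also have "\<dots> \<le> (\<Sum>j=1..k. x (\<sigma> j) * (f (\<sigma> ` {1..j}) - f (\<sigma> ` {1..j-1})))"
    using k incr by (intro sum_mono mult_right_mono) auto
  \<comment> \<open>The terms after \<open>k\<close> are products of a nonnegative coordinate and a
    nonnegative increment.\<close>
  also have "\<dots> \<le> (\<Sum>j=1..n. x (\<sigma> j) * (f (\<sigma> ` {1..j}) - f (\<sigma> ` {1..j-1})))"
  proof (rule sum_mono2)
    fix j assume "j \<in> {1..n} - {1..k}"
    moreover from this have "\<sigma> j \<in> {1..n}" using img by blast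
    ultimately show "0 \<le> x (\<sigma> j) * (f (\<sigma> ` {1..j}) - f (\<sigma> ` {1..j-1}))"
      by (intro mult_nonneg_nonneg incr x) auto
  qed (use k(1) in auto)
  finally show ?thesis by (simp only: L)
qed

text \<open>Sorting an indicator lists the elements of \<open>S\<close> first, so \<open>S\<close>
  is itself a prefix, and the increments along it telescope to \<open>f S\<close>.\<close>

lemma lovasz_extension_indicator:
  assumes f0: "f {} = 0" and S: "S \<subseteq> {1..n}"
  shows "lovasz_extension n f (indicat_real S) = f S"
proof -
  obtain \<sigma> where bij: "bij_betw \<sigma> {1..n} {1..n}"
    and anti: "antimono_on {1..n} (\<lambda>j. indicat_real S (\<sigma> j))"
    and L: "lovasz_extension n f (indicat_real S) =
      (\<Sum>j=1..n. indicat_real S (\<sigma> j) * (f (\<sigma> ` {1..j}) - f (\<sigma> ` {1..j-1})))"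
    by (rule lovasz_extension_ordering)
  \<comment> \<open>An indicator takes only the values 0 and 1, so level 1 picks out exactly the
    positions of elements of \<open>S\<close>.\<close>
  obtain k where "k \<le> n" "{j\<in>{1..n}. indicat_real S (\<sigma> j) \<ge> 1} = {1..k}"
    by (rule antimono_on_superlevel_prefix[OF anti])
  moreover have "indicat_real S a \<ge> 1 \<longleftrightarrow> a \<in> S" for a
    by (simp add: indicator_def)
  ultimately have k: "k \<le> n" "{j\<in>{1..n}. \<sigma> j \<in> S} = {1..k}" by simp_all
  have img: "\<sigma> ` {1..n} = {1..n}" using bij by (simp add: bij_betw_def)
  have S_eq: "\<sigma> ` {1..k} = S"
  proof
    show "\<sigma> ` {1..k} \<subseteq> S" using k(2) by blast
    show "S \<subseteq> \<sigma> ` {1..k}"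
    proof
      fix a assume a: "a \<in> S"
      then obtain j where "j \<in> {1..n}" "a = \<sigma> j" using S img by blast
      with a k(2) show "a \<in> \<sigma> ` {1..k}" by blast
    qed
  qed
  have "lovasz_extension n f (indicat_real S) =
      (\<Sum>j=1..k. indicat_real S (\<sigma> j) * (f (\<sigma> ` {1..j}) - f (\<sigma> ` {1..j-1})))"
    unfolding L
  proof (rule sum.mono_neutral_right)
    show "\<forall>j\<in>{1..n} - {1..k}. indicat_real S (\<sigma> j) * (f (\<sigma> ` {1..j}) - f (\<sigma> ` {1..j-1})) = 0"
      unfolding k(2)[symmetric] by (simp add: indicator_def)
  qed (use k(1) in auto)
  also have "\<dots> = (\<Sum>j=1..k. f (\<sigma> ` {1..j}) - f (\<sigma> ` {1..j-1}))"
    using S_eq by (intro sum.cong refl) (metis image_eqI indicator_simps(1) mult_1)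
  also have "\<dots> = f S"
    by (simp only: sum_prefix_increments S_eq f0 diff_0_right)
  finally show ?thesis .
qed

text \<open>Both weights \<open>1 - lam\<close> and \<open>lam / real m\<close> are
  nonnegative.\<close>

lemma mixed_objective_mono:
  assumes m: "m \<ge> 1" and lam: "0 \<le> lam" "lam \<le> 1"
    and le: "\<And>i. i \<in> {1..m} \<Longrightarrow> v i \<le> w i"
  shows "mixed_objective m lam v \<le> mixed_objective m lam w"
proof -
  have "(MAX i\<in>{1..m}. (1 - lam) * v i) \<le> (MAX i\<in>{1..m}. (1 - lam) * w i)"
  proof (rule Max.boundedI)
    fix a assume "a \<in> (\<lambda>i. (1 - lam) * v i) ` {1..m}"
    then obtain i where i: "i \<in> {1..m}" "a = (1 - lam) * v i" by blast
    then have "a \<le> (1 - lam) * w i" using le lam by (simp add: mult_left_mono)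
    also have "\<dots> \<le> (MAX i\<in>{1..m}. (1 - lam) * w i)" using i by (intro Max_ge) auto
    finally show "a \<le> (MAX i\<in>{1..m}. (1 - lam) * w i)" .
  qed (use m in auto)
  moreover have "lam / real m * (\<Sum>j=1..m. v j) \<le> lam / real m * (\<Sum>j=1..m. w j)"
    using lam le by (intro mult_left_mono sum_mono) auto
  ultimately show ?thesis unfolding mixed_objective_def by (rule add_mono)
qed

lemma mixed_objective_cong:
  assumes "\<And>i. i \<in> {1..m} \<Longrightarrow> v i = w i"
  shows "mixed_objective m lam v = mixed_objective m lam w"
proof -
  have "(\<lambda>i. (1 - lam) * v i) ` {1..m} = (\<lambda>i. (1 - lam) * w i) ` {1..m}"
    by (intro image_cong) (simp_all only: assms)
  moreover have "(\<Sum>j=1..m. v j) = (\<Sum>j=1..m. w j)"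
    by (intro sum.cong) (simp_all only: assms)
  ultimately show ?thesis by (simp only: mixed_objective_def)
qed

lemma mixed_objective_scale:
  assumes "m \<ge> 1" "c \<ge> 0"
  shows "mixed_objective m lam (\<lambda>i. c * v i) = c * mixed_objective m lam v"
proof -
  \<comment> \<open>A monotone map commutes with the maximum of a finite nonempty set.\<close>
  have "mono ((*) c)" using assms by (auto intro!: monoI mult_left_mono)
  then have "c * (MAX i\<in>{1..m}. (1 - lam) * v i) = Max ((*) c ` (\<lambda>i. (1 - lam) * v i) ` {1..m})"
    using assms by (intro mono_Max_commute) auto
  also have "(*) c ` (\<lambda>i. (1 - lam) * v i) ` {1..m} = (\<lambda>i. (1 - lam) * (c * v i)) ` {1..m}"
    by (simp add: image_image mult.left_commute)
  finally show ?thesis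
    by (simp add: mixed_objective_def sum_distrib_left[symmetric] algebra_simps)
qed

text \<open>Each \<open>j\<close> lies in some block, whose indicator alone contributes 1 to the
  covering sum. This makes every partition a competitor in the relaxation.\<close>

lemma feasible_indicator_partition:
  assumes "\<pi> \<in> ordered_partitions n m"
  shows "feasible n m (\<lambda>i. indicat_real (\<pi> i))"
  unfolding feasible_def
proof (intro conjI ballI)
  fix j assume "j \<in> {1..n}"
  then obtain i where i: "i \<in> {1..m}" "j \<in> \<pi> i"
    using assms unfolding ordered_partitions_def by blast
  then have "1 = indicat_real (\<pi> i) j" by simp
  also have "\<dots> \<le> (\<Sum>i=1..m. indicat_real (\<pi> i) j)"
    using i by (intro member_le_sum) auto
  finally show "1 \<le> (\<Sum>i=1..m. indicat_real (\<pi> i) j)" .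
qed (simp add: indicator_def)

lemma arg_max_ge_average:
  fixes g :: "nat \<Rightarrow> real"
  assumes "(\<Sum>i=1..m. g i) \<ge> 1" "is_arg_max g (\<lambda>i. i \<in> {1..m}) k"
  shows "g k \<ge> 1 / real m"
proof -
  have "k \<in> {1..m}" "\<And>i. i \<in> {1..m} \<Longrightarrow> g i \<le> g k"
    using assms(2) by (auto simp: is_arg_max_def not_less)
  then have "m \<ge> 1" "(\<Sum>i=1..m. g i) \<le> real m * g k"
    using sum_bounded_above[of "{1..m}" g "g k"] by auto
  with assms(1) show ?thesis by (simp add: divide_simps mult.commute)
qed

theorem theorem12:
  fixes n m :: nat and lam :: real
    and f :: "nat \<Rightarrow> nat set \<Rightarrow> real"
    and x :: "nat \<Rightarrow> nat \<Rightarrow> real"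
    and h :: "nat \<Rightarrow> nat"
  assumes "m \<ge> 1" and "0 \<le> lam" and "lam \<le> 1"
    and "\<And>i. i \<in> {1..m} \<Longrightarrow> f i {} = 0"
    and "\<And>i. i \<in> {1..m} \<Longrightarrow> mono_on (Pow {1..n}) (f i)"
    and "\<And>i. i \<in> {1..m} \<Longrightarrow> submodular_on {1..n} (f i)"
    and "optimal_solution n m lam f x"
    and "\<And>j. j \<in> {1..n} \<Longrightarrow> is_arg_max (\<lambda>i. x i j) (\<lambda>i. i \<in> {1..m}) (h j)"
  shows "mixed_objective m lam (\<lambda>i. f i (assignment_blocks n m h i))
           \<le> real m * (MIN \<pi>\<in>ordered_partitions n m. mixed_objective m lam (\<lambda>i. f i (\<pi> i)))"
proof -
  let ?obj = "\<lambda>y. mixed_objective m lam (\<lambda>i. lovasz_extension n (f i) (y i))"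
  have feas: "feasible n m x" and opt: "\<And>y. feasible n m y \<Longrightarrow> ?obj x \<le> ?obj y"
    using assms(7) by (auto simp: optimal_solution_def is_arg_min_linorder)
  have block: "f i (assignment_blocks n m h i) \<le> real m * lovasz_extension n (f i) (x i)"
    if i: "i \<in> {1..m}" for i
  proof -
    \<comment> \<open>The level is \<open>1 / real m\<close> because each \<open>j\<close> in block
      \<open>i\<close> has its largest coordinate at \<open>i\<close>, and the maximum is at least
      the average.\<close>
    have "1 / real m * f i (assignment_blocks n m h i) \<le> lovasz_extension n (f i) (x i)"
    proof (rule lovasz_extension_ge_level[OF assms(4)[OF i] assms(5)[OF i]])
      show "x i j \<ge> 0" if "j \<in> {1..n}" for j
        using feas i that by (simp add: feasible_def)
      show "assignment_blocks n m h i \<subseteq> {1..n}"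
        using i by (auto simp: assignment_blocks_def)
      fix j assume "j \<in> assignment_blocks n m h i"
      then have j: "j \<in> {1..n}" "h j = i" using i by (simp_all add: assignment_blocks_def)
      have "(\<Sum>i=1..m. x i j) \<ge> 1"
        using feas j(1) by (simp add: feasible_def)
      from arg_max_ge_average[OF this assms(8)[OF j(1)]]
      show "1 / real m \<le> x i j" by (simp only: j(2))
    qed simp
    then show ?thesis using assms(1) by (simp add: field_simps)
  qed
  \<comment> \<open>The relaxed optimum is a lower bound for the value of every partition.\<close>
  have obj_le: "?obj x \<le> mixed_objective m lam (\<lambda>i. f i (\<pi> i))"
    if \<pi>: "\<pi> \<in> ordered_partitions n m" for \<pi>
  proof -
    have "?obj x \<le> ?obj (\<lambda>i. indicat_real (\<pi> i))"
      by (rule opt[OF feasible_indicator_partition[OF \<pi>]])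
    also have "\<dots> = mixed_objective m lam (\<lambda>i. f i (\<pi> i))"
      using \<pi> assms(4)
      by (intro mixed_objective_cong lovasz_extension_indicator) (auto simp: ordered_partitions_def)
    finally show ?thesis .
  qed
  \<comment> \<open>The factor \<open>real m\<close>, gained blockwise, is pulled out of the
    objective before comparing with partitions.\<close>
  have "mixed_objective m lam (\<lambda>i. f i (assignment_blocks n m h i))
      \<le> mixed_objective m lam (\<lambda>i. real m * lovasz_extension n (f i) (x i))"
    by (rule mixed_objective_mono[OF assms(1-3) block])
  also have "\<dots> = real m * ?obj x"
    by (rule mixed_objective_scale[OF assms(1)]) simp
  also have "\<dots> \<le> real m * (MIN \<pi>\<in>ordered_partitions n m. mixed_objective m lam (\<lambda>i. f i (\<pi> i)))"
    using obj_le ordered_partitions_nonempty[OF assms(1)] finite_ordered_partitions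
    by (intro mult_left_mono Min.boundedI) auto
  finally show ?thesis .
qed

end
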